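(* Let $\mathbb{F}$ be $\mathbb{R}$ or $\mathbb{C}$, let $n\in\mathbb{N}$, let $f=\sum_{\alpha\in\mathbb{N}_0^n}a_\alpha X^{\alpha}$ be a formal power series in $n$ variables over $\mathbb{F}$, and let $G=(g_1,\dots,g_n)$ be a vector of formal power series in $n$ variables over $\mathbb{F}$, with $g_i=\sum_{\gamma\in\mathbb{N}_0^n}b^i_\gamma X^{\gamma}$. Suppose that the family $(G^\alpha)_{\alpha\in\mathbb{N}_0^n}$, where $G^\alpha=\prod_{i=1}^n g_i^{\alpha_i}$, admits addition. Then for every $j\in\{1,\dots,n\}$, $$D_j(f\circ G)=\sum_{i=1}^{n}\bigl(D_i(f)\circ G\bigr)\,D_j(g_i).$$
   Context: $\mathbb{N}$ is the set of positive integers and $\mathbb{N}_0=\mathbb{N}\cup\{0\}$. For $\alpha\in\mathbb{N}_0^n$, $X^\alpha=x_1^{\alpha_1}\cdots x_n^{\alpha_n}$. A formal power series (fps) in $n$ variables over $\mathbb{F}$ is $f=\sum_{\alpha\in\mathbb{N}_0^n}a_\alpha X^\alpha$ with $a_\alpha\in\mathbb{F}$; multiplication is the Cauchy product. Formal partial derivative: for $f=\sum_\alpha a_\alpha X^\alpha$, $D_j(f)=\sum_{\alpha}(\alpha_j+1)\,a_{\alpha+e_j}X^\alpha$, where $e_j\in\mathbb{N}_0^n$ has $1$ in position $j$ and $0$ elsewhere. Formal composition: for $f=\sum_\alpha a_\alpha X^\alpha$ and a vector $G=(g_1,\dots,g_n)$ of fps in $n$ variables, $f\circ G=\sum_\alpha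 a_\alpha G^\alpha$, the sum being taken coefficientwise, provided it exists; in the trivial case where all $g_i=0$ the paper's convention is that $f\circ G=1$. Admits addition: a sequence $(f_1,f_2,\dots)$ of fps $f_i=\sum_\alpha a^i_\alpha X^\alpha$ admits addition if for every $(\beta_1,\dots,\beta_n)\in\mathbb{N}_0^n$ there is a positive integer $N$ such that $a^i_\alpha=0$ for all $i\ge N$ and all $\alpha$ with $0\le\alpha_1\le\beta_1,\dots,0\le\alpha_n\le\beta_n$. For the family $(G^\alpha)_{\alpha\in\mathbb{N}_0^n}$ this means: for every $\beta\in\mathbb{N}_0^n$, for all but finitely many $\alpha\in\mathbb{N}_0^n$ the coefficient of $X^\gamma$ in $G^\alpha$ is zero for every $\gamma$ with $0\le\gamma_i\le\beta_i$ $(i=1,\dots,n)$. *)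

theory Defs
  imports "HOL-Analysis.Infinite_Sum"
begin

typedef ('a, 'n) mfps = "UNIV :: (('n \<Rightarrow> nat) \<Rightarrow> 'a) set"
  morphisms mfps_nth Abs_mfps
  by simp

lemma mfps_nth_Abs [simp]: "mfps_nth (Abs_mfps c) = c"
  by (simp add: Abs_mfps_inverse)

lemma mfps_eqI: "(\<And>\<alpha>. mfps_nth f \<alpha> = mfps_nth g \<alpha>) \<Longrightarrow> f = g"
  by (metis ext mfps_nth_inverse)

lemma finite_atMost_multiindex [simp]: "finite {..\<gamma> :: 'n::finite \<Rightarrow> nat}"
proof -
  have "{..\<gamma>} = PiE UNIV (\<lambda>i. {..\<gamma> i})"
    by (auto simp: le_fun_def PiE_def Pi_iff)
  then show ?thesis
    by (simp add: finite_PiE)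
qed

text \<open>The order on multi-indices is the library's pointwise order on functions and
  \<open>\<gamma> - \<beta>\<close> is pointwise subtraction, so \<open>{..\<gamma>}\<close> is the box of all \<open>\<beta>\<close> with
  \<open>\<beta> i \<le> \<gamma> i\<close> for every \<open>i\<close>.\<close>

instantiation mfps :: (comm_semiring_1, finite) comm_semiring_1
begin

definition zero_mfps_def: "0 = Abs_mfps (\<lambda>_. 0)"

definition one_mfps_def: "1 = Abs_mfps (\<lambda>\<alpha>. if \<alpha> = (\<lambda>_. 0) then 1 else 0)"

definition plus_mfps_def: "f + g = Abs_mfps (\<lambda>\<alpha>. mfps_nth f \<alpha> + mfps_nth g \<alpha>)"

definition times_mfps_def:
  "f * g = Abs_mfps (\<lambda>\<gamma>. \<Sum>\<beta>\<in>{..\<gamma>}. mfps_nth f \<beta> * mfps_nth g (\<gamma> - \<beta>))"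

instance
proof
  fix f g h :: "('a, 'b) mfps"
  show "f + g + h = f + (g + h)" "f + g = g + f" "0 + f = f"
    by (simp_all add: plus_mfps_def zero_mfps_def add_ac mfps_nth_inverse)
  show "0 * f = 0" "f * 0 = 0"
    by (simp_all add: times_mfps_def zero_mfps_def)
  show "(0 :: ('a, 'b) mfps) \<noteq> 1"
  proof
    assume "(0 :: ('a, 'b) mfps) = 1"
    then have "mfps_nth (0 :: ('a, 'b) mfps) (\<lambda>_. 0) = mfps_nth 1 (\<lambda>_. 0)"
      by (rule arg_cong)
    then show False
      by (simp add: zero_mfps_def one_mfps_def)
  qed
  show "(f + g) * h = f * h + g * h"
    by (simp add: times_mfps_def plus_mfps_def distrib_right sum.distrib)
  show "f * g = g * f"
  proof (rule mfps_eqI)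
    fix \<gamma> :: "'b \<Rightarrow> nat"
    have inv: "\<gamma> - (\<gamma> - \<beta>) = \<beta>" if "\<beta> \<le> \<gamma>" for \<beta>
      using that by (auto simp: le_fun_def)
    have le: "\<gamma> - \<beta> \<le> \<gamma>" for \<beta>
      by (simp add: le_fun_def)
    have "(\<Sum>\<beta>\<in>{..\<gamma>}. mfps_nth f \<beta> * mfps_nth g (\<gamma> - \<beta>)) =
        (\<Sum>\<beta>\<in>{..\<gamma>}. mfps_nth g \<beta> * mfps_nth f (\<gamma> - \<beta>))"
      by (rule sum.reindex_bij_witness[where i = "\<lambda>\<beta>. \<gamma> - \<beta>" and j = "\<lambda>\<beta>. \<gamma> - \<beta>"])
         (simp_all add: inv le mult.commute)
    then show "mfps_nth (f * g) \<gamma> = mfps_nth (g * f) \<gamma>"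
      by (simp add: times_mfps_def)
  qed
  show "1 * f = f"
  proof (rule mfps_eqI)
    fix \<gamma> :: "'b \<Rightarrow> nat"
    have "mfps_nth (1 * f) \<gamma> =
        (\<Sum>\<beta>\<in>{..\<gamma>}. if \<beta> = (\<lambda>_. 0) then mfps_nth f \<gamma> else 0)"
      unfolding times_mfps_def one_mfps_def mfps_nth_Abs
      by (rule sum.cong) (auto simp: fun_diff_def)
    then show "mfps_nth (1 * f) \<gamma> = mfps_nth f \<gamma>"
      by (simp add: le_fun_def)
  qed
  show "f * g * h = f * (g * h)"
  proof (rule mfps_eqI)
    fix \<gamma> :: "'b \<Rightarrow> nat"
    have "mfps_nth (f * g * h) \<gamma> = (\<Sum>(\<beta>, \<delta>)\<in>Sigma {..\<gamma>} (\<lambda>\<beta>. {..\<beta>}).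
        mfps_nth f \<delta> * mfps_nth g (\<beta> - \<delta>) * mfps_nth h (\<gamma> - \<beta>))"
      by (simp add: times_mfps_def sum_distrib_right sum.Sigma)
    also have "\<dots> = (\<Sum>(\<delta>, \<epsilon>)\<in>Sigma {..\<gamma>} (\<lambda>\<delta>. {..\<gamma> - \<delta>}).
        mfps_nth f \<delta> * (mfps_nth g \<epsilon> * mfps_nth h (\<gamma> - \<delta> - \<epsilon>)))"
    proof (rule sum.reindex_bij_witness[where i = "\<lambda>(\<delta>, \<epsilon>). (\<lambda>i. \<delta> i + \<epsilon> i, \<delta>)"
          and j = "\<lambda>(\<beta>, \<delta>). (\<delta>, \<beta> - \<delta>)"], goal_cases)
      case (2 p)
      then show ?case
        by (auto intro: order.trans) (auto simp: le_fun_def intro: diff_le_mono)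
    next
      case (3 p)
      then show ?case
        by (auto simp: fun_diff_def)
    next
      case (4 p)
      obtain \<delta> \<epsilon> where p: "p = (\<delta>, \<epsilon>)"
        by (cases p)
      have "\<delta> i + \<epsilon> i \<le> \<gamma> i" for i
      proof -
        from 4 p have "\<delta> i \<le> \<gamma> i" "\<epsilon> i \<le> \<gamma> i - \<delta> i"
          by (auto simp: le_fun_def fun_diff_def)
        then show ?thesis by linarith
      qed
      then show ?case
        by (simp add: p le_fun_def)
    next
      case (5 p)
      obtain \<beta> \<delta> where p: "p = (\<beta>, \<delta>)"
        by (cases p)
      have "\<gamma> - \<delta> - (\<beta> - \<delta>) = \<gamma> - \<beta>"
      proof
        fix i
        from 5 p have "\<delta> i \<le> \<beta> i" "\<beta> i \<le> \<gamma> i"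
          by (auto simp: le_fun_def)
        then show "(\<gamma> - \<delta> - (\<beta> - \<delta>)) i = (\<gamma> - \<beta>) i"
          by simp
      qed
      then show ?case
        by (simp add: p mult.assoc)
    qed (auto simp: le_fun_def fun_diff_def fun_eq_iff)
    also have "\<dots> = mfps_nth (f * (g * h)) \<gamma>"
      by (simp add: times_mfps_def sum_distrib_left sum.Sigma)
    finally show "mfps_nth (f * g * h) \<gamma> = mfps_nth (f * (g * h)) \<gamma>" .
  qed
qed

end

definition mfps_deriv :: "'n \<Rightarrow> ('a::comm_semiring_1, 'n) mfps \<Rightarrow> ('a, 'n) mfps" where
  "mfps_deriv j f =
     Abs_mfps (\<lambda>\<alpha>. of_nat (\<alpha> j + 1) * mfps_nth f (\<alpha>(j := \<alpha> j + 1)))"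

definition mfps_multipower ::
    "('n \<Rightarrow> ('a::comm_semiring_1, 'n::finite) mfps) \<Rightarrow> ('n \<Rightarrow> nat) \<Rightarrow> ('a, 'n) mfps" where
  "mfps_multipower G \<alpha> = (\<Prod>i\<in>UNIV. G i ^ \<alpha> i)"

text \<open>For families indexed by the natural numbers, finiteness of the exceptional set says that
  there is an index from which on no member has a nonzero coefficient in the box.\<close>

definition admits_addition :: "('i \<Rightarrow> ('a::zero, 'n) mfps) \<Rightarrow> bool" where
  "admits_addition F \<longleftrightarrow> (\<forall>\<beta>. finite {i. \<exists>\<gamma>\<le>\<beta>. mfps_nth (F i) \<gamma> \<noteq> 0})"

text \<open>The composite with the zero vector is \<open>1\<close> by convention.  Otherwise the coefficients are
  unordered infinite sums; \<open>infsum\<close> is only meaningful when these exist, that is, under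
  \<open>mfps_composable\<close>.\<close>

definition mfps_composable ::
    "('a::real_normed_field, 'n::finite) mfps \<Rightarrow> ('n \<Rightarrow> ('a, 'n) mfps) \<Rightarrow> bool" where
  "mfps_composable f G \<longleftrightarrow>
     (\<forall>\<gamma>. (\<lambda>\<alpha>. mfps_nth f \<alpha> * mfps_nth (mfps_multipower G \<alpha>) \<gamma>) summable_on UNIV)"

definition mfps_compose ::
    "('a::real_normed_field, 'n::finite) mfps \<Rightarrow> ('n \<Rightarrow> ('a, 'n) mfps) \<Rightarrow> ('a, 'n) mfps" where
  "mfps_compose f G =
     (if \<forall>i. G i = 0 then 1
      else Abs_mfps (\<lambda>\<gamma>. \<Sum>\<^sub>\<infinity>\<alpha>. mfps_nth f \<alpha> * mfps_nth (mfps_multipower G \<alpha>) \<gamma>))"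

lemma admits_addition_imp_composable:
  assumes "admits_addition (mfps_multipower G)"
  shows "mfps_composable f G"
  unfolding mfps_composable_def
proof
  fix \<gamma>
  let ?S = "{\<alpha>. \<exists>\<delta>\<le>\<gamma>. mfps_nth (mfps_multipower G \<alpha>) \<delta> \<noteq> 0}"
  let ?h = "\<lambda>\<alpha>. mfps_nth f \<alpha> * mfps_nth (mfps_multipower G \<alpha>) \<gamma>"
  have "?h summable_on ?S"
    using assms by (simp add: admits_addition_def)
  moreover have "?h summable_on ?S \<longleftrightarrow> ?h summable_on UNIV"
    by (rule summable_on_cong_neutral) auto
  ultimately show "?h summable_on UNIV"
    by simp
qed

end

theory Submission imports Defs begin

text \<open>
  The chain rule is first of all a statement about the monomials \<open>G\<^sup>\<alpha>\<close>.  The formal derivative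
  satisfies the Leibniz rule and sends \<open>1\<close> to \<open>0\<close>, and this alone gives
  \<open>D\<^sub>j (G\<^sup>\<alpha>) = (\<Sum>i. \<alpha>\<^sub>i G\<^bsup>\<alpha> - e\<^sub>i\<^esup> D\<^sub>j g\<^sub>i)\<close> (lemma \<open>mfps_deriv_multipower\<close>).  Multiplying by \<open>a\<^sub>\<alpha>\<close>, summing over
  \<open>\<alpha>\<close> and substituting \<open>\<alpha> = \<alpha>' + e\<^sub>i\<close> in the \<open>i\<close>-th summand turns the coefficient \<open>a\<^sub>\<alpha> \<alpha>\<^sub>i\<close> into
  \<open>(\<alpha>'\<^sub>i + 1) a\<^bsub>\<alpha>' + e\<^sub>i\<^esub>\<close>, which is the coefficient of \<open>D\<^sub>i f\<close> at \<open>\<alpha>'\<close>.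

  The interchanges of sums are harmless because everything can be read off one coefficient at a time.
  When the family of the \<open>G\<^sup>\<alpha>\<close> admits addition, only finitely many \<open>\<alpha>\<close> contribute to the coefficients of a
  composite below a fixed \<open>\<gamma>\<close>.  A product coefficient at \<open>\<gamma>\<close> only involves coefficients of the factors
  below \<open>\<gamma>\<close>, so the same finite set of \<open>\<alpha>\<close> also serves for products of a composite with any other series
  (lemma \<open>mfps_compose_times_nth\<close>).  All sums over \<open>\<alpha>\<close> thus become finite.

  The zero vector falls outside this argument, since the composite with it is \<open>1\<close> by convention; there
  both sides are zero because \<open>D\<^sub>j 1\<close> and all \<open>D\<^sub>j 0\<close> are.
\<close>

section \<open>The formal derivative as a derivation\<close>

lemma mfps_nth_zero [simp]: "mfps_nth 0 \<gamma> = 0"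
  by (simp add: zero_mfps_def)

lemma mfps_nth_plus [simp]: "mfps_nth (f + g) \<gamma> = mfps_nth f \<gamma> + mfps_nth g \<gamma>"
  by (simp add: plus_mfps_def)

lemma mfps_nth_times:
  "mfps_nth (f * g) \<gamma> = (\<Sum>\<beta>\<in>{..\<gamma>}. mfps_nth f \<beta> * mfps_nth g (\<gamma> - \<beta>))"
  by (simp add: times_mfps_def)

lemma mfps_nth_sum: "mfps_nth (\<Sum>i\<in>A. F i) \<gamma> = (\<Sum>i\<in>A. mfps_nth (F i) \<gamma>)"
  by (induction A rule: infinite_finite_induct) auto

lemma mfps_nth_of_nat_times: "mfps_nth (of_nat k * f) \<gamma> = of_nat k * mfps_nth f \<gamma>"
  by (induction k) (auto simp: distrib_right)

lemma mfps_deriv_nth: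
  "mfps_nth (mfps_deriv j f) \<gamma> = of_nat (Suc (\<gamma> j)) * mfps_nth f (\<gamma>(j := Suc (\<gamma> j)))"
  by (simp add: mfps_deriv_def)

lemma mfps_deriv_zero [simp]: "mfps_deriv j 0 = 0"
  by (rule mfps_eqI) (simp add: mfps_deriv_nth)

lemma mfps_deriv_one [simp]: "mfps_deriv j (1 :: ('a::comm_semiring_1, 'n::finite) mfps) = 0"
proof (rule mfps_eqI)
  fix \<gamma> :: "'n \<Rightarrow> nat"
  have "\<gamma>(j := Suc (\<gamma> j)) \<noteq> (\<lambda>_. 0)"
    by (metis fun_upd_same nat.distinct(1))
  then show "mfps_nth (mfps_deriv j (1 :: ('a, 'n) mfps)) \<gamma> = mfps_nth 0 \<gamma>"
    by (simp add: mfps_deriv_nth one_mfps_def)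
qed

text \<open>At \<open>\<gamma>\<close> the left-hand side is \<open>\<gamma>\<^sub>j + 1\<close> times a sum over \<open>\<beta> \<le> \<gamma> + e\<^sub>j\<close>.  Splitting the factor as
  \<open>\<beta>\<^sub>j + (\<gamma>\<^sub>j + 1 - \<beta>\<^sub>j)\<close> separates the two products: the first part vanishes at \<open>\<beta>\<^sub>j = 0\<close> and becomes a sum
  over the box below \<open>\<gamma>\<close> after the shift \<open>\<beta> \<mapsto> \<beta> + e\<^sub>j\<close>, the second vanishes at \<open>\<beta>\<^sub>j = \<gamma>\<^sub>j + 1\<close> and needs no
  shift.\<close>

lemma mfps_deriv_times:
  fixes f g :: "('a::comm_semiring_1, 'n::finite) mfps"
  shows "mfps_deriv j (f * g) = mfps_deriv j f * g + f * mfps_deriv j g"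
proof (rule mfps_eqI)
  fix \<gamma> :: "'n \<Rightarrow> nat"
  define up :: "('n \<Rightarrow> nat) \<Rightarrow> 'n \<Rightarrow> nat" where "up \<beta> = \<beta>(j := Suc (\<beta> j))" for \<beta>
  define t where "t \<beta> = mfps_nth f \<beta> * mfps_nth g (up \<gamma> - \<beta>)" for \<beta>
  have le_upD: "\<beta> j \<le> Suc (\<gamma> j)" if "\<beta> \<le> up \<gamma>" for \<beta>
    using le_funD[OF that, of j] by (simp add: up_def)
  have le_up: "\<beta> \<le> up \<gamma>" if "\<beta> \<le> \<gamma>" for \<beta>
    using that by (auto simp: up_def le_fun_def le_SucI)
  have inj: "inj_on up {..\<gamma>}"
    by (rule inj_onI) (metis (no_types) Suc_inject fun_upd_apply fun_upd_triv fun_upd_upd up_def)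
  have image_up: "up ` {..\<gamma>} = {\<beta> \<in> {..up \<gamma>}. \<beta> j \<noteq> 0}"
  proof (intro equalityI subsetI)
    fix \<beta> assume "\<beta> \<in> {\<beta> \<in> {..up \<gamma>}. \<beta> j \<noteq> 0}"
    then have le: "\<And>i. \<beta> i \<le> up \<gamma> i" and nz: "\<beta> j \<noteq> 0"
      by (auto simp: le_fun_def)
    have "(\<beta>(j := \<beta> j - 1)) i \<le> \<gamma> i" for i
      using le[of i] by (auto simp: up_def)
    then have "\<beta>(j := \<beta> j - 1) \<in> {..\<gamma>}"
      by (auto simp: le_fun_def)
    moreover have "\<beta> = up (\<beta>(j := \<beta> j - 1))"
      using nz by (simp add: up_def)
    ultimately show "\<beta> \<in> up ` {..\<gamma>}"
      by (metis imageI)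
  qed (auto simp: up_def le_fun_def)
  have first: "(\<Sum>\<beta>\<in>{..up \<gamma>}. of_nat (\<beta> j) * t \<beta>) = mfps_nth (mfps_deriv j f * g) \<gamma>"
  proof -
    have "(\<Sum>\<beta>\<in>{..up \<gamma>}. of_nat (\<beta> j) * t \<beta>) = (\<Sum>\<beta>\<in>up ` {..\<gamma>}. of_nat (\<beta> j) * t \<beta>)"
      unfolding image_up by (rule sum.mono_neutral_right) auto
    also have "\<dots> = (\<Sum>\<beta>\<in>{..\<gamma>}. of_nat (up \<beta> j) * t (up \<beta>))"
      by (simp add: sum.reindex[OF inj])
    also have "\<dots> = mfps_nth (mfps_deriv j f * g) \<gamma>"
      unfolding mfps_nth_times
    proof (rule sum.cong)
      fix \<beta> assume "\<beta> \<in> {..\<gamma>}"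
      have "up \<gamma> - up \<beta> = \<gamma> - \<beta>"
        by (auto simp: up_def fun_eq_iff)
      then show "of_nat (up \<beta> j) * t (up \<beta>) = mfps_nth (mfps_deriv j f) \<beta> * mfps_nth g (\<gamma> - \<beta>)"
        by (simp add: t_def mfps_deriv_nth up_def mult.assoc)
    qed simp
    finally show ?thesis .
  qed
  have second: "(\<Sum>\<beta>\<in>{..up \<gamma>}. of_nat (Suc (\<gamma> j) - \<beta> j) * t \<beta>) = mfps_nth (f * mfps_deriv j g) \<gamma>"
  proof -
    have zero: "Suc (\<gamma> j) - \<beta> j = 0" if "\<beta> \<in> {..up \<gamma>} - {..\<gamma>}" for \<beta>
    proof (rule ccontr)
      assume *: "Suc (\<gamma> j) - \<beta> j \<noteq> 0"
      from that have le: "\<beta> i \<le> up \<gamma> i" for i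
        by (simp add: le_fun_def)
      then have "\<beta> i \<le> \<gamma> i" for i
        using * le[of i] by (cases "i = j") (auto simp: up_def)
      with that show False
        by (simp add: le_fun_def)
    qed
    have "(\<Sum>\<beta>\<in>{..up \<gamma>}. of_nat (Suc (\<gamma> j) - \<beta> j) * t \<beta>) =
        (\<Sum>\<beta>\<in>{..\<gamma>}. of_nat (Suc (\<gamma> j) - \<beta> j) * t \<beta>)"
    proof (rule sum.mono_neutral_right)
      show "\<forall>\<beta>\<in>{..up \<gamma>} - {..\<gamma>}. of_nat (Suc (\<gamma> j) - \<beta> j) * t \<beta> = 0"
        by (metis zero of_nat_0 mult_zero_left)
    qed (use le_up in auto)
    also have "\<dots> = mfps_nth (f * mfps_deriv j g) \<gamma>"
      unfolding mfps_nth_times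
    proof (rule sum.cong)
      fix \<beta> assume "\<beta> \<in> {..\<gamma>}"
      then have le: "\<beta> j \<le> \<gamma> j"
        by (simp add: le_fun_def)
      then have "up \<gamma> - \<beta> = up (\<gamma> - \<beta>)"
        by (auto simp: up_def fun_eq_iff)
      then show "of_nat (Suc (\<gamma> j) - \<beta> j) * t \<beta> = mfps_nth f \<beta> * mfps_nth (mfps_deriv j g) (\<gamma> - \<beta>)"
        using le by (simp add: t_def mfps_deriv_nth up_def Suc_diff_le mult.left_commute del: of_nat_Suc)
    qed simp
    finally show ?thesis .
  qed
  have "mfps_nth (mfps_deriv j (f * g)) \<gamma> = (\<Sum>\<beta>\<in>{..up \<gamma>}. of_nat (Suc (\<gamma> j)) * t \<beta>)"
    by (simp add: mfps_deriv_nth mfps_nth_times t_def up_def[symmetric] sum_distrib_left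
        del: of_nat_Suc)
  also have "\<dots> = (\<Sum>\<beta>\<in>{..up \<gamma>}. of_nat (\<beta> j) * t \<beta> + of_nat (Suc (\<gamma> j) - \<beta> j) * t \<beta>)"
  proof (rule sum.cong)
    fix \<beta> assume "\<beta> \<in> {..up \<gamma>}"
    then have "\<beta> j + (Suc (\<gamma> j) - \<beta> j) = Suc (\<gamma> j)"
      using le_upD by simp
    then show "of_nat (Suc (\<gamma> j)) * t \<beta> = of_nat (\<beta> j) * t \<beta> + of_nat (Suc (\<gamma> j) - \<beta> j) * t \<beta>"
      by (metis distrib_right of_nat_add)
  qed simp
  also have "\<dots> = mfps_nth (mfps_deriv j f * g + f * mfps_deriv j g) \<gamma>"
    by (simp only: sum.distrib first second mfps_nth_plus)
  finally show "mfps_nth (mfps_deriv j (f * g)) \<gamma> =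
      mfps_nth (mfps_deriv j f * g + f * mfps_deriv j g) \<gamma>" .
qed

lemma mfps_deriv_power:
  fixes g :: "('a::comm_semiring_1, 'n::finite) mfps"
  shows "mfps_deriv j (g ^ k) = of_nat k * (g ^ (k - 1) * mfps_deriv j g)"
proof (induction k)
  case (Suc k)
  then show ?case
    by (cases k) (simp_all add: mfps_deriv_times algebra_simps)
qed simp

lemma mfps_deriv_prod:
  fixes h :: "'i \<Rightarrow> ('a::comm_semiring_1, 'n::finite) mfps"
  assumes "finite A"
  shows "mfps_deriv j (\<Prod>i\<in>A. h i) = (\<Sum>i\<in>A. mfps_deriv j (h i) * (\<Prod>k\<in>A - {i}. h k))"
  using assms
proof (induction A)
  case (insert x A)
  have "(\<Sum>i\<in>A. mfps_deriv j (h i) * (\<Prod>k\<in>insert x A - {i}. h k)) =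
      (\<Sum>i\<in>A. h x * (mfps_deriv j (h i) * (\<Prod>k\<in>A - {i}. h k)))"
  proof (rule sum.cong)
    fix i assume "i \<in> A"
    with insert have "insert x A - {i} = insert x (A - {i})"
      by auto
    with insert show "mfps_deriv j (h i) * (\<Prod>k\<in>insert x A - {i}. h k) =
        h x * (mfps_deriv j (h i) * (\<Prod>k\<in>A - {i}. h k))"
      by (simp add: mult.left_commute)
  qed simp
  with insert show ?case
    by (simp add: mfps_deriv_times sum_distrib_left)
qed simp

text \<open>The exponent \<open>\<alpha>\<^sub>i - 1\<close> is truncated at \<open>\<alpha>\<^sub>i = 0\<close>, where the factor \<open>\<alpha>\<^sub>i\<close> removes the summand.\<close>

lemma mfps_deriv_multipower:
  "mfps_deriv j (mfps_multipower G \<alpha>) =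
    (\<Sum>i\<in>UNIV. of_nat (\<alpha> i) * (mfps_multipower G (\<alpha>(i := \<alpha> i - 1)) * mfps_deriv j (G i)))"
proof -
  have "mfps_multipower G (\<alpha>(i := \<alpha> i - 1)) = G i ^ (\<alpha> i - 1) * (\<Prod>k\<in>UNIV - {i}. G k ^ \<alpha> k)" for i
  proof -
    have "mfps_multipower G (\<alpha>(i := \<alpha> i - 1)) =
        G i ^ (\<alpha> i - 1) * (\<Prod>k\<in>UNIV - {i}. G k ^ ((\<alpha>(i := \<alpha> i - 1)) k))"
      by (simp add: mfps_multipower_def prod.remove[of UNIV i])
    also have "(\<Prod>k\<in>UNIV - {i}. G k ^ ((\<alpha>(i := \<alpha> i - 1)) k)) = (\<Prod>k\<in>UNIV - {i}. G k ^ \<alpha> k)"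
      by (rule prod.cong) auto
    finally show ?thesis .
  qed
  then show ?thesis
    by (simp add: mfps_multipower_def[of G \<alpha>] mfps_deriv_prod mfps_deriv_power mult_ac)
qed

section \<open>Composites as finite sums\<close>

lemma mfps_compose_nth:
  assumes "\<exists>i. G i \<noteq> 0" and "finite A" and "\<And>\<alpha>. \<alpha> \<notin> A \<Longrightarrow> mfps_nth (mfps_multipower G \<alpha>) \<gamma> = 0"
  shows "mfps_nth (mfps_compose f G) \<gamma> =
    (\<Sum>\<alpha>\<in>A. mfps_nth f \<alpha> * mfps_nth (mfps_multipower G \<alpha>) \<gamma>)"
proof -
  have "(\<Sum>\<^sub>\<infinity>\<alpha>. mfps_nth f \<alpha> * mfps_nth (mfps_multipower G \<alpha>) \<gamma>) =
      (\<Sum>\<^sub>\<infinity>\<alpha>\<in>A. mfps_nth f \<alpha> * mfps_nth (mfps_multipower G \<alpha>) \<gamma>)"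
    using assms(3) by (intro infsum_cong_neutral) auto
  with assms(1,2) show ?thesis
    by (auto simp: mfps_compose_def)
qed

lemma mfps_times_nth_eq_0:
  assumes "\<And>\<beta>. \<beta> \<le> \<gamma> \<Longrightarrow> mfps_nth f \<beta> = 0"
  shows "mfps_nth (f * h) \<gamma> = 0"
  using assms by (simp add: mfps_nth_times)

text \<open>The finite set \<open>A\<close> has to work for the whole box below \<open>\<gamma>\<close>, since the product mixes all
  coefficients of the composite in that box; then the two finite sums can be exchanged.\<close>

lemma mfps_compose_times_nth:
  assumes "\<exists>i. G i \<noteq> 0" and "finite A"
    and "\<And>\<alpha> \<beta>. \<alpha> \<notin> A \<Longrightarrow> \<beta> \<le> \<gamma> \<Longrightarrow> mfps_nth (mfps_multipower G \<alpha>) \<beta> = 0"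
  shows "mfps_nth (mfps_compose f G * h) \<gamma> =
    (\<Sum>\<alpha>\<in>A. mfps_nth f \<alpha> * mfps_nth (mfps_multipower G \<alpha> * h) \<gamma>)"
proof -
  have "mfps_nth (mfps_compose f G * h) \<gamma> = (\<Sum>\<beta>\<in>{..\<gamma>}. \<Sum>\<alpha>\<in>A.
      mfps_nth f \<alpha> * (mfps_nth (mfps_multipower G \<alpha>) \<beta> * mfps_nth h (\<gamma> - \<beta>)))"
    unfolding mfps_nth_times using assms
    by (intro sum.cong) (simp_all add: mfps_compose_nth[of G A] sum_distrib_right mult.assoc)
  also have "\<dots> = (\<Sum>\<alpha>\<in>A. mfps_nth f \<alpha> * mfps_nth (mfps_multipower G \<alpha> * h) \<gamma>)"
    by (subst sum.swap) (simp add: mfps_nth_times sum_distrib_left)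
  finally show ?thesis .
qed

section \<open>The chain rule\<close>

theorem mfps_deriv_compose:
  fixes f :: "('a::real_normed_field, 'n::finite) mfps" and G :: "'n \<Rightarrow> ('a, 'n) mfps"
  assumes adm: "admits_addition (mfps_multipower G)"
  shows "mfps_deriv j (mfps_compose f G) =
    (\<Sum>i\<in>UNIV. mfps_compose (mfps_deriv i f) G * mfps_deriv j (G i))"
proof (cases "\<forall>i. G i = 0")
  case True
  then show ?thesis
    by (simp add: mfps_compose_def)
next
  case False
  then have nz: "\<exists>i. G i \<noteq> 0"
    by simp
  show ?thesis
  proof (rule mfps_eqI)
    fix \<gamma> :: "'n \<Rightarrow> nat"
    define up :: "'n \<Rightarrow> ('n \<Rightarrow> nat) \<Rightarrow> 'n \<Rightarrow> nat" where "up i \<alpha> = \<alpha>(i := Suc (\<alpha> i))" for i \<alpha>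
    define S where "S \<beta> = {\<alpha>. \<exists>\<delta>\<le>\<beta>. mfps_nth (mfps_multipower G \<alpha>) \<delta> \<noteq> 0}" for \<beta>
    \<comment> \<open>Besides the indices needed for the left-hand side, \<open>A\<close> contains all the shifts \<open>\<alpha>' + e\<^sub>i\<close> of the
      indices needed for the right-hand side.\<close>
    define A where "A = S (up j \<gamma>) \<union> (\<Union>i. up i ` S \<gamma>)"
    have fin: "finite (S \<beta>)" for \<beta>
      using adm by (simp add: admits_addition_def S_def)
    then have finA: "finite A"
      by (simp add: A_def)
    have inj: "inj_on (up i) B" for i B
      by (rule inj_onI) (metis (no_types) Suc_inject fun_upd_apply fun_upd_triv fun_upd_upd up_def)
    have zeroA: "mfps_nth (mfps_multipower G \<alpha>) (up j \<gamma>) = 0" if "\<alpha> \<notin> A" for \<alpha>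
      using that by (auto simp: A_def S_def)
    define c where "c i \<alpha> = mfps_nth f \<alpha> * (of_nat (\<alpha> i) *
        mfps_nth (mfps_multipower G (\<alpha>(i := \<alpha> i - 1)) * mfps_deriv j (G i)) \<gamma>)" for i \<alpha>
    have zero: "c i \<alpha> = 0" if "\<alpha> \<notin> up i ` S \<gamma>" for i \<alpha>
    proof (cases "\<alpha> i = 0")
      case False
      then have "\<alpha> = up i (\<alpha>(i := \<alpha> i - 1))"
        by (simp add: up_def)
      with that have "\<alpha>(i := \<alpha> i - 1) \<notin> S \<gamma>"
        by blast
      then show ?thesis
        by (auto simp: c_def S_def intro: mfps_times_nth_eq_0)
    qed (simp add: c_def)
    have "mfps_nth (mfps_deriv j (mfps_compose f G)) \<gamma> =
        of_nat (Suc (\<gamma> j)) * mfps_nth (mfps_compose f G) (up j \<gamma>)"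
      by (simp add: mfps_deriv_nth up_def)
    also have "\<dots> = (\<Sum>\<alpha>\<in>A. mfps_nth f \<alpha> * mfps_nth (mfps_deriv j (mfps_multipower G \<alpha>)) \<gamma>)"
      using zeroA by (simp add: mfps_compose_nth[OF nz finA] mfps_deriv_nth up_def[symmetric]
          sum_distrib_left mult.left_commute del: of_nat_Suc)
    also have "\<dots> = (\<Sum>\<alpha>\<in>A. \<Sum>i\<in>UNIV. c i \<alpha>)"
      by (simp add: mfps_deriv_multipower mfps_nth_sum mfps_nth_of_nat_times sum_distrib_left c_def)
    also have "\<dots> = (\<Sum>i\<in>UNIV. \<Sum>\<alpha>\<in>A. c i \<alpha>)"
      by (rule sum.swap)
    also have "\<dots> = (\<Sum>i\<in>UNIV. mfps_nth (mfps_compose (mfps_deriv i f) G * mfps_deriv j (G i)) \<gamma>)"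
    proof (rule sum.cong)
      fix i :: 'n
      have "(\<Sum>\<alpha>\<in>A. c i \<alpha>) = (\<Sum>\<alpha>\<in>up i ` S \<gamma>. c i \<alpha>)"
        using finA zero by (intro sum.mono_neutral_right) (auto simp: A_def)
      also have "\<dots> = (\<Sum>\<alpha>\<in>S \<gamma>. c i (up i \<alpha>))"
        by (simp add: sum.reindex[OF inj])
      also have "\<dots> = (\<Sum>\<alpha>\<in>S \<gamma>. mfps_nth (mfps_deriv i f) \<alpha> *
          mfps_nth (mfps_multipower G \<alpha> * mfps_deriv j (G i)) \<gamma>)"
        by (simp add: c_def up_def mfps_deriv_nth mult_ac del: of_nat_Suc)
      also have "\<dots> = mfps_nth (mfps_compose (mfps_deriv i f) G * mfps_deriv j (G i)) \<gamma>"
        by (rule mfps_compose_times_nth[symmetric, OF nz fin]) (auto simp: S_def)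
      finally show "(\<Sum>\<alpha>\<in>A. c i \<alpha>) =
          mfps_nth (mfps_compose (mfps_deriv i f) G * mfps_deriv j (G i)) \<gamma>" .
    qed simp
    finally show "mfps_nth (mfps_deriv j (mfps_compose f G)) \<gamma> =
        mfps_nth (\<Sum>i\<in>UNIV. mfps_compose (mfps_deriv i f) G * mfps_deriv j (G i)) \<gamma>"
      by (simp add: mfps_nth_sum)
  qed
qed

theorem theorem21:
  "(\<forall>(f :: (real, 'n::finite) mfps) (G :: 'n \<Rightarrow> (real, 'n) mfps).
      admits_addition (mfps_multipower G) \<longrightarrow>
      (\<forall>j. mfps_deriv j (mfps_compose f G) =
           (\<Sum>i\<in>UNIV. mfps_compose (mfps_deriv i f) G * mfps_deriv j (G i)))) \<and>
   (\<forall>(f :: (complex, 'n) mfps) (G :: 'n \<Rightarrow> (complex, 'n) mfps).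
      admits_addition (mfps_multipower G) \<longrightarrow>
      (\<forall>j. mfps_deriv j (mfps_compose f G) =
           (\<Sum>i\<in>UNIV. mfps_compose (mfps_deriv i f) G * mfps_deriv j (G i))))"
  by (intro conjI allI impI mfps_deriv_compose)

end
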